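(* Let $\lambda$ be a positive real number and let $t\in\mathbb{Z}_{\ge 0}$. (i) If $p\ge q$ (i.e., $(Z_t)_{t\ge 0}$ is a submartingale), then $$\lambda P(M_t\ge\lambda)\le\lceil\lambda\rceil P(M_t\ge\lambda)\le E[\mathbf{1}_{\{M_t\ge\lambda\}}Z_t].$$ (ii) If $p\le q$, then $$E[\mathbf{1}_{\{M_t\ge\lambda\}}Z_t]\le\lceil\lambda\rceil P(M_t\ge\lambda).$$ In particular, if $p=q$, then $\lceil\lambda\rceil P(M_t\ge\lambda)=E[\mathbf{1}_{\{M_t\ge\lambda\}}Z_t]$.
   Context: $\mathbb{Z}_{\ge 0}$ denotes the set of nonnegative integers; $\lceil x\rceil$ is the least integer greater than or equal to $x\in\mathbb{R}$; $\mathbf{1}_A$ is the indicator of an event $A$. Let $\xi_1,\xi_2,\dots$ be i.i.d. random variables on a probability space $(\Omega,\mathcal{F},P)$ with $P(\xi_1=1)=p$, $P(\xi_1=-1)=q$, $P(\xi_1=0)=r$, where $p>0$, $q>0$ (and $r\ge 0$), $p+q+r=1$. The random walk is $Z_0=0$, $Z_{t+1}=Z_t+\xi_{t+1}$ for $t\in\mathbb{Z}_{\ge 0}$, its maximum process is $M_t=\max_{0\le s\le t}Z_s$, and the filtration is the natural one, $\mathcal{F}_t=\sigma(Z_s: s\le t)$. *)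

theory Defs
  imports "HOL-Probability.Probability"
begin

locale lazy_random_walk = prob_space M
  for M :: "'a measure" +
  fixes \<xi> :: "nat \<Rightarrow> 'a \<Rightarrow> real" and p q r :: real
  assumes indep: "indep_vars (\<lambda>_. borel) \<xi> {1..}"
    and ident: "\<And>n. n \<ge> 1 \<Longrightarrow> distr M borel (\<xi> n) = distr M borel (\<xi> 1)"
    and up: "prob {\<omega> \<in> space M. \<xi> 1 \<omega> = 1} = p"
    and down: "prob {\<omega> \<in> space M. \<xi> 1 \<omega> = -1} = q"
    and stay: "prob {\<omega> \<in> space M. \<xi> 1 \<omega> = 0} = r"
    and p_pos: "p > 0" and q_pos: "q > 0" and r_nonneg: "r \<ge> 0"
    and total: "p + q + r = 1"

text \<open>The value \<open>\<xi> 0\<close> is never used: the increments are indexed from 1.\<close>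

primrec walk :: "(nat \<Rightarrow> 'a \<Rightarrow> real) \<Rightarrow> nat \<Rightarrow> 'a \<Rightarrow> real" where
  "walk \<xi> 0 \<omega> = 0"
| "walk \<xi> (Suc t) \<omega> = walk \<xi> t \<omega> + \<xi> (Suc t) \<omega>"

definition running_max :: "(nat \<Rightarrow> 'a \<Rightarrow> real) \<Rightarrow> nat \<Rightarrow> 'a \<Rightarrow> real" where
  "running_max X t \<omega> = Max ((\<lambda>s. X s \<omega>) ` {0..t})"

definition natural_filtration :: "'a measure \<Rightarrow> (nat \<Rightarrow> 'a \<Rightarrow> real) \<Rightarrow> nat \<Rightarrow> 'a measure" where
  "natural_filtration M X t =
     sigma (space M) (\<Union>s\<in>{0..t}. {X s -` A \<inter> space M | A. A \<in> sets borel})"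

definition submartingale :: "'a measure \<Rightarrow> (nat \<Rightarrow> 'a measure) \<Rightarrow> (nat \<Rightarrow> 'a \<Rightarrow> real) \<Rightarrow> bool" where
  "submartingale M F X \<longleftrightarrow>
     (\<forall>t. subalgebra M (F t)) \<and>
     (\<forall>s t. s \<le> t \<longrightarrow> sets (F s) \<subseteq> sets (F t)) \<and>
     (\<forall>t. X t \<in> borel_measurable (F t)) \<and>
     (\<forall>t. integrable M (X t)) \<and>
     (\<forall>t. AE \<omega> in M. X t \<omega> \<le> real_cond_exp M (F t) (X (Suc t)) \<omega>)"

context lazy_random_walk
begin

lemma measurable_step: "n \<ge> 1 \<Longrightarrow> \<xi> n \<in> borel_measurable M"
  using indep by (auto simp: indep_vars_def)

lemma AE_step:
  assumes n: "n \<ge> 1"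
  shows "AE \<omega> in M. \<xi> n \<omega> \<in> {-1, 0, 1}"
proof -
  have [measurable]: "\<xi> n \<in> borel_measurable M" "\<xi> 1 \<in> borel_measurable M"
    using n by (auto intro!: measurable_step)
  have "{x \<in> space borel. x \<in> {-1, 0, 1::real}} = {-1, 0, 1}"
    by auto
  then have S: "{x \<in> space borel. x \<in> {-1, 0, 1::real}} \<in> sets borel"
    by (metis borel_closed finite.emptyI finite.insertI finite_imp_closed)
  have "prob {\<omega> \<in> space M. \<xi> 1 \<omega> \<in> {-1, 0, 1}}
      = prob (({\<omega> \<in> space M. \<xi> 1 \<omega> = 1} \<union> {\<omega> \<in> space M. \<xi> 1 \<omega> = -1})
          \<union> {\<omega> \<in> space M. \<xi> 1 \<omega> = 0})"
    by (rule arg_cong[where f = prob]) auto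
  also have "\<dots> = p + q + r"
    unfolding up[symmetric] down[symmetric] stay[symmetric]
    by (subst finite_measure_Union, measurable, force)+ simp
  finally have "AE \<omega> in M. \<xi> 1 \<omega> \<in> {-1, 0, 1}"
    by (subst prob_Collect_eq_1[symmetric]) (measurable, simp only: total)
  then have "AE x in distr M borel (\<xi> 1). x \<in> {-1, 0, 1}"
    unfolding AE_distr_iff[OF measurable_step[OF order_refl] S] .
  then have "AE x in distr M borel (\<xi> n). x \<in> {-1, 0, 1}"
    unfolding ident[OF n] .
  then show ?thesis
    unfolding AE_distr_iff[OF measurable_step[OF n] S] .
qed

lemma integrable_step: "n \<ge> 1 \<Longrightarrow> integrable M (\<xi> n)"
  by (rule integrable_const_bound[where B = 1])
    (use AE_step[of n] measurable_step in auto)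

lemma integrable_walk: "integrable M (walk \<xi> t)"
proof (induction t)
  case 0
  then show ?case by simp
next
  case (Suc t)
  then have "integrable M (\<lambda>\<omega>. walk \<xi> t \<omega> + \<xi> (Suc t) \<omega>)"
    by (intro Bochner_Integration.integrable_add integrable_step) auto
  then show ?case by simp
qed

end

end

theory Submission
  imports Defs
begin

text \<open>
  Write \<open>A\<^sub>t\<close> for the event that the maximum up to time \<open>t\<close> is at least \<open>l\<close>, put
  \<open>k = \<lceil>l\<rceil>\<close>, and consider the excess \<open>D\<^sub>t = 1\<^bsub>A\<^sub>t\<^esub> (Z\<^sub>t - k)\<close>. The walk moves on the integers with
  steps of size at most one, so it cannot jump over the level \<open>k\<close>: when \<open>A\<^bsub>t+1\<^esub>\<close> occurs but
  \<open>A\<^sub>t\<close> does not, the walk sits exactly at \<open>k\<close> at time \<open>t + 1\<close> and its excess is zero. Hence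
  \<open>D\<^bsub>t+1\<^esub> = D\<^sub>t + 1\<^bsub>A\<^sub>t\<^esub> \<xi>\<^bsub>t+1\<^esub>\<close> almost surely. Since \<open>A\<^sub>t\<close> depends on the past only, it is
  independent of \<open>\<xi>\<^bsub>t+1\<^esub>\<close>, which has mean \<open>p - q\<close>. Taking expectations and summing from
  \<open>D\<^sub>0 = 0\<close> gives the identity \<open>excess_identity\<close>,
  \<open>E[1\<^bsub>A\<^sub>t\<^esub> Z\<^sub>t] = k P(A\<^sub>t) + (p - q) (P(A\<^sub>0) + ... + P(A\<^bsub>t-1\<^esub>))\<close>.
  All three comparisons are the sign of its last term.

  The same independence, \<open>step_independent_of_past\<close>, shows that the conditional mean of
  \<open>Z\<^bsub>t+1\<^esub>\<close> given the past is \<open>Z\<^sub>t + (p - q)\<close>, so that the walk is a submartingale exactly when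
  \<open>p \<ge> q\<close>.
\<close>

context lazy_random_walk
begin

abbreviation "\<F> \<equiv> natural_filtration M (walk \<xi>)"

section \<open>The natural filtration and the drift of the walk\<close>

lemma mean_step:
  assumes n: "n \<ge> 1"
  shows "expectation (\<xi> n) = p - q"
proof -
  have [measurable]: "\<xi> (Suc 0) \<in> borel_measurable M" "\<xi> n \<in> borel_measurable M"
    using n by (auto intro!: measurable_step)
  have "expectation (\<xi> n) = (\<integral>x. x \<partial>distr M borel (\<xi> n))"
    by (subst integral_distr) auto
  also have "\<dots> = (\<integral>x. x \<partial>distr M borel (\<xi> 1))"
    by (simp only: ident[OF n])
  also have "\<dots> = expectation (\<xi> 1)"
    by (simp add: integral_distr)
  also have "\<dots> = (\<integral>\<omega>. indicator {\<omega> \<in> space M. \<xi> 1 \<omega> = 1} \<omega>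
      - indicator {\<omega> \<in> space M. \<xi> 1 \<omega> = -1} \<omega> \<partial>M)"
    by (rule integral_cong_AE) (use AE_step[of 1] in \<open>auto simp: indicator_def elim!: eventually_mono\<close>)
  also have "\<dots> = p - q"
    using up down
    by (subst Bochner_Integration.integral_diff) (simp_all add: integrable_indicator_iff less_top[symmetric])
  finally show ?thesis .
qed

lemma measurable_walk: "walk \<xi> t \<in> borel_measurable M"
  using integrable_walk by auto

lemma sets_natural_filtration:
  "sets (\<F> t) = sigma_sets (space M) (\<Union>s\<in>{0..t}. {walk \<xi> s -` A \<inter> space M | A. A \<in> sets borel})"
  unfolding natural_filtration_def by (intro sets_measure_of) auto

lemma space_natural_filtration [simp]: "space (\<F> t) = space M"
  unfolding natural_filtration_def by (simp add: space_measure_of_conv)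

lemma subalgebra_natural_filtration: "subalgebra M (\<F> t)"
  unfolding subalgebra_def sets_natural_filtration
  using measurable_sets[OF measurable_walk]
  by (auto intro!: sets.sigma_sets_subset)

lemma natural_filtration_mono: "s \<le> t \<Longrightarrow> sets (\<F> s) \<subseteq> sets (\<F> t)"
  unfolding sets_natural_filtration
  by (intro sigma_sets_mono' UN_mono) auto

lemma walk_adapted: "s \<le> t \<Longrightarrow> walk \<xi> s \<in> borel_measurable (\<F> t)"
  unfolding measurable_def sets_natural_filtration
  by (fastforce intro: sigma_sets.Basic)

text \<open>
  An event of the past is determined by the vector of the first \<open>t\<close> steps, because every
  earlier position of the walk is a sum of those steps. This vector is independent of step
  \<open>t + 1\<close>, so the expectation of the product factorises.
\<close>

lemma step_independent_of_past:
  assumes A: "A \<in> sets (\<F> t)"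
  shows "(\<integral>\<omega>. indicator A \<omega> * \<xi> (Suc t) \<omega> \<partial>M) = (p - q) * prob A"
proof -
  define P where "P = (\<Pi>\<^sub>M i\<in>{1..t}. (borel :: real measure))"
  define X where "X \<omega> = restrict (\<lambda>i. \<xi> i \<omega>) {1..t}" for \<omega>
  \<comment> \<open>The next step is viewed as a one-entry vector, so that disjoint blocks of an independent
    family can be compared.\<close>
  define Y where "Y \<omega> = restrict (\<lambda>i. \<xi> i \<omega>) {Suc t}" for \<omega>
  have X_step: "(\<lambda>\<omega>. \<xi> s \<omega>) \<in> borel_measurable (vimage_algebra (space M) X P)"
    if "s \<in> {1..t}" for s
  proof -
    have "X \<in> measurable (vimage_algebra (space M) X P) P"
      by (rule measurable_vimage_algebra1)
         (auto simp: X_def P_def space_PiM)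
    then have "(\<lambda>\<omega>. X \<omega> s) \<in> borel_measurable (vimage_algebra (space M) X P)"
      unfolding P_def by (rule measurable_compose[OF _ measurable_component_singleton[OF that]])
    then show ?thesis using that by (simp add: X_def)
  qed
  have X_walk: "walk \<xi> s \<in> borel_measurable (vimage_algebra (space M) X P)" if "s \<le> t" for s
    using that
  proof (induction s)
    case (Suc s)
    then have "(\<lambda>\<omega>. walk \<xi> s \<omega> + \<xi> (Suc s) \<omega>) \<in> borel_measurable (vimage_algebra (space M) X P)"
      by (intro borel_measurable_add X_step) auto
    then show ?case by simp
  next
    case 0
    have "walk \<xi> 0 = (\<lambda>_. 0)" by auto
    then show ?case by simp
  qed
  have "sets (\<F> t) \<subseteq> sets (vimage_algebra (space M) X P)"
    unfolding sets_natural_filtration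
    using measurable_sets[OF X_walk] sets.top[of "vimage_algebra (space M) X P"]
    by (intro sets.sigma_sets_subset') auto
  with A have "A \<in> sets (vimage_algebra (space M) X P)" by auto
  moreover have "X \<in> space M \<rightarrow> space P"
    by (auto simp: X_def P_def space_PiM)
  ultimately obtain B where B: "B \<in> sets P" "A = X -` B \<inter> space M"
    by (auto simp: sets_vimage_algebra2)
  have "indep_var P X (\<Pi>\<^sub>M i\<in>{Suc t}. borel) Y"
    unfolding P_def X_def[abs_def] Y_def[abs_def]
    by (rule indep_var_restrict[OF indep]) auto
  then have "indep_var borel (indicator B \<circ> X) borel ((\<lambda>y. y (Suc t)) \<circ> Y)"
    by (rule indep_var_compose) (use B in auto)
  moreover have "((\<lambda>y. y (Suc t)) \<circ> Y) = \<xi> (Suc t)"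
    by (auto simp: Y_def)
  ultimately have iv: "indep_var borel (indicator B \<circ> X :: 'a \<Rightarrow> real) borel (\<xi> (Suc t))"
    by metis
  have A_M: "A \<in> sets M"
    using A subalgebra_natural_filtration by (auto simp: subalgebra_def)
  have ind: "indicator A \<omega> = (indicator B \<circ> X) \<omega>" if "\<omega> \<in> space M" for \<omega>
    using that by (auto simp: B indicator_def)
  have int: "integrable M (indicator B \<circ> X :: 'a \<Rightarrow> real)"
    using A_M by (subst Bochner_Integration.integrable_cong[OF refl ind[symmetric]]) (auto simp: less_top[symmetric])
  have "(\<integral>\<omega>. indicator A \<omega> * \<xi> (Suc t) \<omega> \<partial>M) = (\<integral>\<omega>. (indicator B \<circ> X) \<omega> * \<xi> (Suc t) \<omega> \<partial>M)"
    by (intro Bochner_Integration.integral_cong) (simp_all add: ind)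
  also have "\<dots> = expectation (indicator B \<circ> X) * expectation (\<xi> (Suc t))"
    by (rule indep_var_lebesgue_integral[OF iv int integrable_step]) simp
  also have "expectation (indicator B \<circ> X) = expectation (indicator A)"
    by (intro Bochner_Integration.integral_cong) (simp_all add: ind)
  finally show ?thesis
    using A_M by (simp add: mean_step)
qed

lemma cond_exp_walk:
  "AE \<omega> in M. real_cond_exp M (\<F> t) (walk \<xi> (Suc t)) \<omega> = walk \<xi> t \<omega> + (p - q)"
proof -
  interpret S: finite_measure_subalgebra M "\<F> t"
    by unfold_locales (rule subalgebra_natural_filtration)
  show ?thesis
  proof (rule S.real_cond_exp_charact)
    fix A assume A: "A \<in> sets (\<F> t)"
    then have A_M: "A \<in> sets M"
      using subalgebra_natural_filtration by (auto simp: subalgebra_def)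
    have i1: "integrable M (\<lambda>\<omega>. indicator A \<omega> * walk \<xi> t \<omega>)"
      using integrable_mult_indicator[OF A_M integrable_walk] by simp
    have i2: "integrable M (\<lambda>\<omega>. indicator A \<omega> * \<xi> (Suc t) \<omega>)"
      using integrable_mult_indicator[OF A_M integrable_step[of "Suc t"]] by simp
    have i3: "integrable M (\<lambda>\<omega>. indicator A \<omega> * (p - q))"
      using A_M by (auto simp: less_top[symmetric])
    have "(\<integral>\<omega>\<in>A. walk \<xi> (Suc t) \<omega> \<partial>M)
        = (\<integral>\<omega>. indicator A \<omega> * walk \<xi> t \<omega> \<partial>M) + (\<integral>\<omega>. indicator A \<omega> * \<xi> (Suc t) \<omega> \<partial>M)"
      using Bochner_Integration.integral_add[OF i1 i2]
      by (simp add: set_lebesgue_integral_def algebra_simps)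
    also have "\<dots> = (\<integral>\<omega>. indicator A \<omega> * walk \<xi> t \<omega> \<partial>M) + (\<integral>\<omega>. indicator A \<omega> * (p - q) \<partial>M)"
      using A_M by (simp add: step_independent_of_past[OF A])
    also have "\<dots> = (\<integral>\<omega>\<in>A. (walk \<xi> t \<omega> + (p - q)) \<partial>M)"
      using Bochner_Integration.integral_add[OF i1 i3]
      by (simp add: set_lebesgue_integral_def algebra_simps)
    finally show "(\<integral>\<omega>\<in>A. walk \<xi> (Suc t) \<omega> \<partial>M) = (\<integral>\<omega>\<in>A. (walk \<xi> t \<omega> + (p - q)) \<partial>M)" .
  next
    show "integrable M (\<lambda>\<omega>. walk \<xi> t \<omega> + (p - q))"
      by (intro Bochner_Integration.integrable_add integrable_walk) simp
    show "(\<lambda>\<omega>. walk \<xi> t \<omega> + (p - q)) \<in> borel_measurable (\<F> t)"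
      by (intro borel_measurable_add walk_adapted) auto
  qed (rule integrable_walk)
qed

text \<open>
  The conditional drift is the constant \<open>p - q\<close>, so its sign can be read off at time 0 already.
\<close>

lemma submartingale_walk_iff: "submartingale M \<F> (walk \<xi>) \<longleftrightarrow> q \<le> p"
proof
  assume "q \<le> p"
  then show "submartingale M \<F> (walk \<xi>)"
    unfolding submartingale_def
    using subalgebra_natural_filtration natural_filtration_mono walk_adapted integrable_walk
  proof (intro conjI allI impI)
    show "AE \<omega> in M. walk \<xi> t \<omega> \<le> real_cond_exp M (\<F> t) (walk \<xi> (Suc t)) \<omega>" for t
      using cond_exp_walk[of t] by eventually_elim (use \<open>q \<le> p\<close> in simp)
  qed auto
next
  assume "submartingale M \<F> (walk \<xi>)"
  then have "AE \<omega> in M. walk \<xi> 0 \<omega> \<le> real_cond_exp M (\<F> 0) (walk \<xi> (Suc 0)) \<omega>"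
    by (auto simp only: submartingale_def)
  with cond_exp_walk[of 0] have "AE \<omega> in M. q \<le> p"
    by eventually_elim simp
  then show "q \<le> p"
    by simp
qed

section \<open>First passage to a level\<close>

lemma running_max_ge_iff: "l \<le> running_max X t \<omega> \<longleftrightarrow> (\<exists>s\<le>t. l \<le> X s \<omega>)" for l :: real
  unfolding running_max_def by (subst Max_ge_iff) auto

lemma maximal_event_adapted:
  "{\<omega> \<in> space M. l \<le> running_max (walk \<xi>) t \<omega>} \<in> sets (\<F> t)"
proof -
  have "{\<omega> \<in> space M. l \<le> running_max (walk \<xi>) t \<omega>}
      = (\<Union>s\<in>{..t}. {\<omega> \<in> space (\<F> t). l \<le> walk \<xi> s \<omega>})"
    by (auto simp: running_max_ge_iff)
  also have "\<dots> \<in> sets (\<F> t)"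
    by (intro sets.finite_UN borel_measurable_le borel_measurable_const walk_adapted) auto
  finally show ?thesis .
qed

lemma walk_in_Ints:
  assumes "\<And>n. n \<ge> 1 \<Longrightarrow> \<xi> n \<omega> \<in> {-1, 0, 1}"
  shows "walk \<xi> t \<omega> \<in> \<int>"
proof (induction t)
  case (Suc t)
  then show ?case using assms[of "Suc t"] by auto
qed simp

text \<open>
  Below \<open>l\<close> the walk is at an integer \<open>m < l\<close>, and only an upward step can carry it to \<open>l\<close>;
  then \<open>m < l \<le> m + 1\<close>, that is, \<open>m + 1 = \<lceil>l\<rceil>\<close>.
\<close>

lemma walk_at_first_passage:
  assumes steps: "\<And>n. n \<ge> 1 \<Longrightarrow> \<xi> n \<omega> \<in> {-1, 0, 1}"
    and below: "\<not> l \<le> running_max (walk \<xi>) t \<omega>"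
    and above: "l \<le> running_max (walk \<xi>) (Suc t) \<omega>"
  shows "walk \<xi> (Suc t) \<omega> = of_int \<lceil>l\<rceil>"
proof -
  obtain m where m: "walk \<xi> t \<omega> = of_int m"
    using walk_in_Ints[OF steps] by (auto elim: Ints_cases)
  have "of_int m < l" "l \<le> of_int m + \<xi> (Suc t) \<omega>"
    using below above m by (auto simp: running_max_ge_iff le_Suc_eq not_le dest: leD)
  moreover from this have "\<xi> (Suc t) \<omega> = 1"
    using steps[of "Suc t"] by auto
  ultimately have "\<lceil>l\<rceil> = m + 1" and "\<xi> (Suc t) \<omega> = 1"
    by (simp_all add: ceiling_eq_iff)
  then show ?thesis using m by simp
qed

text \<open>
  The expected excess over the level \<open>\<lceil>l\<rceil>\<close> grows by \<open>p - q\<close> times the probability that the level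
  has been reached already: reaching it for the first time contributes nothing.
\<close>

lemma excess_identity:
  assumes l: "l > 0"
  defines "A \<equiv> \<lambda>t. {\<omega> \<in> space M. l \<le> running_max (walk \<xi>) t \<omega>}"
  shows "(\<integral>\<omega>. indicator (A t) \<omega> * walk \<xi> t \<omega> \<partial>M)
    = of_int \<lceil>l\<rceil> * prob (A t) + (p - q) * (\<Sum>s<t. prob (A s))"
proof -
  have A_F: "A s \<in> sets (\<F> s)" for s
    unfolding A_def by (rule maximal_event_adapted)
  have A_M [measurable]: "A s \<in> sets M" for s
    using A_F subalgebra_natural_filtration by (auto simp: subalgebra_def)
  define D where "D s \<omega> = indicator (A s) \<omega> * (walk \<xi> s \<omega> - of_int \<lceil>l\<rceil>)" for s \<omega>
  have int_walk: "integrable M (\<lambda>\<omega>. indicator (A s) \<omega> * walk \<xi> s \<omega>)" for s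
    using integrable_mult_indicator[OF A_M integrable_walk] by simp
  have int_step: "integrable M (\<lambda>\<omega>. indicator (A s) \<omega> * \<xi> (Suc s) \<omega>)" for s
    using integrable_mult_indicator[OF A_M integrable_step[of "Suc s"]] by simp
  have int_ind: "integrable M (\<lambda>\<omega>. indicator (A s) \<omega> * (of_int \<lceil>l\<rceil> :: real))" for s
    by (auto simp: less_top[symmetric])
  have D_alt: "D s = (\<lambda>\<omega>. indicator (A s) \<omega> * walk \<xi> s \<omega> - indicator (A s) \<omega> * of_int \<lceil>l\<rceil>)" for s
    by (auto simp: D_def algebra_simps)
  have int_D: "integrable M (D s)" for s
    unfolding D_alt by (intro Bochner_Integration.integrable_diff int_walk int_ind)
  \<comment> \<open>Outside \<open>A s\<close> both sides vanish, either because the level is still not reached or because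
    the walk has just arrived at it; inside \<open>A s\<close> the level stays reached.\<close>
  have D_step: "AE \<omega> in M. D (Suc s) \<omega> = D s \<omega> + indicator (A s) \<omega> * \<xi> (Suc s) \<omega>" for s
  proof -
    have "AE \<omega> in M. \<forall>n. n \<ge> 1 \<longrightarrow> \<xi> n \<omega> \<in> {-1, 0, 1}"
      unfolding AE_all_countable using AE_step by (auto simp del: insert_iff)
    then show ?thesis
    proof (eventually_elim)
      fix \<omega> assume steps: "\<forall>n. n \<ge> 1 \<longrightarrow> \<xi> n \<omega> \<in> {-1, 0, 1}"
      have mono: "\<omega> \<in> A s \<Longrightarrow> \<omega> \<in> A (Suc s)"
        by (auto simp: A_def running_max_ge_iff intro: le_SucI)
      have "walk \<xi> (Suc s) \<omega> = of_int \<lceil>l\<rceil>" if "\<omega> \<in> A (Suc s)" "\<omega> \<notin> A s"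
        using that steps by (intro walk_at_first_passage) (auto simp: A_def)
      then show "D (Suc s) \<omega> = D s \<omega> + indicator (A s) \<omega> * \<xi> (Suc s) \<omega>"
        using mono by (cases "\<omega> \<in> A s"; cases "\<omega> \<in> A (Suc s)") (auto simp: D_def)
    qed
  qed
  have "expectation (D t) = (p - q) * (\<Sum>s<t. prob (A s))"
  proof (induction t)
    case 0
    \<comment> \<open>The walk starts at 0, strictly below \<open>l\<close>; positivity of \<open>l\<close> enters here.\<close>
    have "A 0 = {}" using l by (auto simp: A_def running_max_ge_iff)
    then show ?case by (simp add: D_def)
  next
    case (Suc t)
    have "expectation (D (Suc t)) = (\<integral>\<omega>. D t \<omega> + indicator (A t) \<omega> * \<xi> (Suc t) \<omega> \<partial>M)"
      by (intro integral_cong_AE D_step borel_measurable_integrable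
          Bochner_Integration.integrable_add int_D int_step)
    also have "\<dots> = expectation (D t) + (p - q) * prob (A t)"
      by (simp only: Bochner_Integration.integral_add[OF int_D int_step] step_independent_of_past[OF A_F])
    finally show ?case using Suc by (simp add: algebra_simps)
  qed
  moreover have "expectation (D t) = (\<integral>\<omega>. indicator (A t) \<omega> * walk \<xi> t \<omega> \<partial>M) - of_int \<lceil>l\<rceil> * prob (A t)"
    unfolding D_alt by (subst Bochner_Integration.integral_diff[OF int_walk int_ind]) simp
  ultimately show ?thesis by simp
qed

end

theorem proposition3:
  fixes M :: "'a measure" and \<xi> :: "nat \<Rightarrow> 'a \<Rightarrow> real"
    and p q r l :: real and t :: nat
  assumes "lazy_random_walk M \<xi> p q r"
    and "l > 0"
  defines "Z \<equiv> walk \<xi>"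
  defines "A \<equiv> {\<omega> \<in> space M. running_max Z t \<omega> \<ge> l}"
  shows "(p \<ge> q \<longleftrightarrow> submartingale M (natural_filtration M Z) Z) \<and>
    (p \<ge> q \<longrightarrow>
       l * measure M A \<le> of_int \<lceil>l\<rceil> * measure M A \<and>
       of_int \<lceil>l\<rceil> * measure M A \<le> (\<integral>\<omega>. indicator A \<omega> * Z t \<omega> \<partial>M)) \<and>
    (p \<le> q \<longrightarrow>
       (\<integral>\<omega>. indicator A \<omega> * Z t \<omega> \<partial>M) \<le> of_int \<lceil>l\<rceil> * measure M A) \<and>
    (p = q \<longrightarrow>
       of_int \<lceil>l\<rceil> * measure M A = (\<integral>\<omega>. indicator A \<omega> * Z t \<omega> \<partial>M))"
proof -
  interpret lazy_random_walk M \<xi> p q r by fact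
  define c where "c = (\<Sum>s<t. prob {\<omega> \<in> space M. l \<le> running_max (walk \<xi>) s \<omega>})"
  have "c \<ge> 0"
    unfolding c_def by (intro sum_nonneg) simp
  have E: "(\<integral>\<omega>. indicator A \<omega> * Z t \<omega> \<partial>M) = of_int \<lceil>l\<rceil> * prob A + (p - q) * c"
    unfolding A_def Z_def c_def by (rule excess_identity[OF \<open>l > 0\<close>])
  have "l * prob A \<le> of_int \<lceil>l\<rceil> * prob A"
    by (intro mult_right_mono) auto
  moreover have "p \<ge> q \<Longrightarrow> (p - q) * c \<ge> 0" "p \<le> q \<Longrightarrow> (p - q) * c \<le> 0"
    using \<open>c \<ge> 0\<close> by (simp_all add: mult_nonpos_nonneg)
  ultimately show ?thesis
    unfolding E using submartingale_walk_iff by (auto simp: Z_def)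
qed

end
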